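(* Let $\widetilde{F}$ and $\widetilde{F}_n$ ($n\ge 1$) be probability measures on $\Theta$ with respective mixture densities $$\tilde{p}(x)=\int_\Theta p(x|\theta)\,\widetilde{F}(d\theta),\qquad \tilde{p}_n(x)=\int_\Theta p(x|\theta)\,\widetilde{F}_n(d\theta).$$ Suppose that $\tilde{p}_n\to\tilde{p}$ in $L_1$, and that the following hold: (A2) the map $F\mapsto\int_\Theta p(x|\theta)\,F(d\theta)$ is injective; that is, the mixing distribution $F$ is identifiable from the mixture $\int_\Theta p(x|\theta)\,F(d\theta)$; (A3) for each $x\in\mathcal{X}$, the map $\theta\mapsto p(x|\theta)$ is bounded and continuous; (A4) for any $\varepsilon>0$ and any compact $\mathcal{X}_0\subset\mathcal{X}$, there exists a compact $\Theta_0\subset\Theta$ such that $\int_{\mathcal{X}_0}p(x|\theta)\,\nu(dx)<\varepsilon$ for all $\theta\notin\Theta_0$. Then $\widetilde{F}_n\to\widetilde{F}$ in the weak topology.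
   Context: For each $\theta\in\Theta$, $p(\cdot|\theta)$ is a known sampling density on $\mathcal{X}$ with respect to a dominating $\sigma$-finite measure $\nu$. Convergence in $L_1$ is with respect to $\nu$. Compactness and continuity refer to the topologies of the sample space $\mathcal{X}$ and the parameter space $\Theta$. In (A2), $F$ ranges over probability measures on $\Theta$. The weak topology is the topology of weak convergence of probability measures on $\Theta$ (convergence of integrals of bounded continuous functions).
   Formalization: The sample space is assumed Polish with its Borel sets and the parameter space separable metrizable (the claim fails for arbitrary topological sample spaces); in (A2) mixtures are identified as densities, that is up to ν-almost everywhere equality. *)

theory Defs
  imports "HOL-Probability.Probability"
begin

definition borel_prob :: "'t::topological_space measure \<Rightarrow> bool" where
  "borel_prob F \<longleftrightarrow> prob_space F \<and> sets F = sets borel"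

definition density_wrt :: "'x measure \<Rightarrow> ('x \<Rightarrow> real) \<Rightarrow> bool" where
  "density_wrt \<nu> q \<longleftrightarrow>
     q \<in> borel_measurable \<nu> \<and> (\<forall>x. 0 \<le> q x) \<and> (\<integral>\<^sup>+x. ennreal (q x) \<partial>\<nu>) = 1"

definition mixture :: "('x \<Rightarrow> 't \<Rightarrow> real) \<Rightarrow> 't measure \<Rightarrow> 'x \<Rightarrow> real" where
  "mixture p F x = (\<integral>\<theta>. p x \<theta> \<partial>F)"

(* A mixture is regarded as a density, i.e. modulo equality nu-almost everywhere;
   this is injectivity of the map F |-> mixture p F into L1(nu). *)
definition identifiable :: "'x measure \<Rightarrow> ('x \<Rightarrow> 't::topological_space \<Rightarrow> real) \<Rightarrow> bool" where
  "identifiable \<nu> p \<longleftrightarrow>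
     (\<forall>F G. borel_prob F \<longrightarrow> borel_prob G \<longrightarrow>
        (AE x in \<nu>. mixture p F x = mixture p G x) \<longrightarrow> F = G)"

(* The nonnegative integral avoids the default value 0 of the Bochner integral
   on non-integrable functions. *)
definition tendsto_L1 :: "'x measure \<Rightarrow> (nat \<Rightarrow> 'x \<Rightarrow> real) \<Rightarrow> ('x \<Rightarrow> real) \<Rightarrow> bool" where
  "tendsto_L1 \<nu> g h \<longleftrightarrow>
     (\<lambda>n. \<integral>\<^sup>+x. ennreal \<bar>g n x - h x\<bar> \<partial>\<nu>) \<longlonglongrightarrow> 0"

(* The library's weak_conv_m covers measures on the real line only. *)
definition tendsto_weakly :: "(nat \<Rightarrow> 't::topological_space measure) \<Rightarrow> 't measure \<Rightarrow> bool" where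
  "tendsto_weakly Fs F \<longleftrightarrow>
     (\<forall>f :: 't \<Rightarrow> real. continuous_on UNIV f \<longrightarrow> bounded (range f) \<longrightarrow>
        (\<lambda>n. \<integral>\<theta>. f \<theta> \<partial>Fs n) \<longlonglongrightarrow> (\<integral>\<theta>. f \<theta> \<partial>F))"

end

theory Submission
  imports Defs
begin

text \<open>
  The weak limit of a subsequence exists because the mixing measures are uniformly tight. Since
  \<open>\<X>\<close> is Polish, an \<open>L\<^sub>1\<close>-convergent sequence of densities puts almost all of its mass on one compact
  set \<open>X\<close>. By (A4) the kernel mass \<open>\<integral>\<^sub>X p(x|\<theta>) \<nu>(dx)\<close> is small off some compact \<open>T\<close>, and
  by Fubini the mixture mass of \<open>X\<close> is the mean of the kernel mass under the mixing measure; hence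
  the mixing measure of \<open>T\<close> must be close to one (\<open>mixing_measures_tight\<close>). Fubini requires \<open>p\<close> to
  be jointly measurable, which follows from measurability in \<open>x\<close> and continuity in \<open>\<theta>\<close>
  (\<open>caratheodory_measurable\<close>).

  Given any subsequence, pass to a further one along which the mixtures converge almost everywhere,
  and then to one along which the mixing measures converge weakly to some \<open>G\<close>. As \<open>p(x|\<cdot>)\<close> is bounded
  and continuous, the mixtures also converge pointwise to the mixture of \<open>G\<close>. So the mixtures of \<open>G\<close>
  and of the given limit agree almost everywhere, and (A2) identifies the two. Every subsequence thus has
  a further subsequence with the desired limit.

  The remaining ingredient is the direct half of Prokhorov's theorem on a separable metric space
  (\<open>tight_imp_weakly_convergent_subsequence\<close>). It is reduced to the Helly selection theorem on the
  real line: tightness concentrates all the measures on a \<open>\<sigma>\<close>-compact set, such a set can be coded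
  by real numbers in a measurable way whose inverse extends continuously to the closure of the
  codes (\<open>sigma_compact_coding\<close>), and a weak limit of the coded measures is carried back by that
  extension.
\<close>

section \<open>Coding a sigma-compact set by real numbers\<close>

text \<open>
  Reading a set of indices as base-three digits from \<open>{0, 1}\<close> leaves a gap between the codes of two
  digit sequences that differ early, so that, unlike with binary expansions, nearby codes force
  equal leading digits.
\<close>

definition ternary_code :: "(nat \<Rightarrow> bool) \<Rightarrow> real" where
  "ternary_code a = (\<Sum>k. of_bool (a k) * (1/3) ^ k)"

lemma summable_ternary:
  fixes d :: "nat \<Rightarrow> real"
  assumes "\<And>k. \<bar>d k\<bar> \<le> 1"
  shows "summable (\<lambda>k. d k * (1/3) ^ k)"
  by (rule summable_comparison_test'[where g="\<lambda>k. (1/3::real) ^ k"])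
     (use assms in \<open>auto simp: abs_mult intro!: mult_left_le_one_le\<close>)

lemma abs_suminf_ternary_le:
  fixes d :: "nat \<Rightarrow> real"
  assumes d: "\<And>k. \<bar>d k\<bar> \<le> 1"
  shows "\<bar>\<Sum>k. d k * (1/3) ^ k\<bar> \<le> 3/2"
proof -
  have "norm (\<Sum>k. d k * (1/3) ^ k) \<le> (\<Sum>k. (1/3::real) ^ k)"
    by (rule norm_suminf_le)
       (use d in \<open>auto simp: abs_mult intro!: mult_left_le_one_le\<close>)
  also have "\<dots> = 3/2"
    by (simp add: suminf_geometric)
  finally show ?thesis by simp
qed

lemma ternary_code_bounds: "0 \<le> ternary_code a" "ternary_code a \<le> 3/2"
proof -
  show "0 \<le> ternary_code a"
    unfolding ternary_code_def by (intro suminf_nonneg summable_ternary) auto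
  show "ternary_code a \<le> 3/2"
    using abs_suminf_ternary_le[of "\<lambda>k. of_bool (a k)"] unfolding ternary_code_def by simp
qed

text \<open>
  At the first index \<open>m\<close> of disagreement the codes differ by \<open>3\<^sup>-\<^sup>m\<close>, and all the later digits
  together can compensate at most half of that.
\<close>

lemma ternary_code_separates:
  assumes close: "\<bar>ternary_code a - ternary_code b\<bar> < (1/3) ^ N" and "k < N"
  shows "a k = b k"
proof (rule ccontr)
  assume "a k \<noteq> b k"
  define d :: "nat \<Rightarrow> real" where "d k = of_bool (a k) - of_bool (b k)" for k
  define m where "m = (LEAST k. a k \<noteq> b k)"
  have m: "a m \<noteq> b m"
    unfolding m_def using \<open>a k \<noteq> b k\<close> by (rule LeastI)
  have m_le: "m \<le> k"
    unfolding m_def using \<open>a k \<noteq> b k\<close> by (rule Least_le)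
  have zero: "d j = 0" if "j < m" for j
    using not_less_Least[of j "\<lambda>k. a k \<noteq> b k"] that unfolding m_def d_def by auto
  have d: "\<bar>d j\<bar> \<le> 1" for j by (auto simp: d_def)
  have dm: "\<bar>d m\<bar> = 1" using m by (auto simp: d_def)
  have "ternary_code a - ternary_code b = (\<Sum>k. d k * (1/3) ^ k)"
    unfolding ternary_code_def d_def
    by (subst suminf_diff) (auto intro!: summable_ternary simp: algebra_simps)
  also have "\<dots> = (\<Sum>k. d (k + Suc m) * (1/3) ^ (k + Suc m)) + (\<Sum>k<Suc m. d k * (1/3) ^ k)"
    by (rule suminf_split_initial_segment[OF summable_ternary[OF d]])
  also have "(\<Sum>k<Suc m. d k * (1/3) ^ k) = d m * (1/3) ^ m"
    using zero by simp
  also have "(\<Sum>k. d (k + Suc m) * (1/3) ^ (k + Suc m)) =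
      (\<Sum>k. d (k + Suc m) * (1/3) ^ k) * (1/3) ^ Suc m"
    by (subst suminf_mult2[OF summable_ternary]) (auto simp: d power_add mult_ac)
  finally have eq: "ternary_code a - ternary_code b =
      (\<Sum>k. d (k + Suc m) * (1/3) ^ k) * (1/3) ^ Suc m + d m * (1/3) ^ m" .
  have "\<bar>(\<Sum>k. d (k + Suc m) * (1/3) ^ k) * (1/3) ^ Suc m\<bar> \<le> (3/2) * (1/3) ^ Suc m"
    unfolding abs_mult using abs_suminf_ternary_le[of "\<lambda>k. d (k + Suc m)"] d
    by (intro mult_mono) auto
  moreover have "\<bar>d m * (1/3) ^ m\<bar> = (1/3) ^ m" using dm by (simp add: abs_mult)
  ultimately have "(3/2) * (1/3) ^ Suc m \<le> \<bar>ternary_code a - ternary_code b\<bar>"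
    unfolding eq power_Suc by linarith
  moreover have "(1/3::real) ^ N \<le> (1/3) ^ Suc m"
    using m_le \<open>k < N\<close> by (intro power_decreasing) auto
  moreover have "(0::real) < (1/3) ^ Suc m" by simp
  ultimately show False using close by linarith
qed

lemma borel_measurable_ternary_code:
  assumes "\<And>k. B k \<in> sets M"
  shows "(\<lambda>x. ternary_code (\<lambda>k. x \<in> B k)) \<in> borel_measurable M"
proof -
  have "(\<lambda>x. of_bool (x \<in> B k) :: real) = indicator (B k)" for k
    by (auto simp: indicator_def)
  then have "(\<lambda>x. of_bool (x \<in> B k) * (1/3) ^ k :: real) \<in> borel_measurable M" for k
    using assms[of k] by simp
  then show ?thesis unfolding ternary_code_def by (rule borel_measurable_suminf)
qed

lemma countable_basis_sequence:
  "\<exists>B :: nat \<Rightarrow> 't::second_countable_topology set.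
     (\<forall>k. open (B k)) \<and> (\<forall>U x. open U \<longrightarrow> x \<in> U \<longrightarrow> (\<exists>k. x \<in> B k \<and> B k \<subseteq> U))"
proof -
  obtain A :: "'t set set" where A: "countable A" "topological_basis A"
    using ex_countable_basis by blast
  have "A \<noteq> {}"
    using topological_basisE[OF A(2) open_UNIV UNIV_I] by blast
  then have r: "range (from_nat_into A) = A"
    using A(1) by (rule range_from_nat_into)
  show ?thesis
  proof (intro exI[of _ "from_nat_into A"] conjI allI impI)
    show "open (from_nat_into A k)" for k
      using r A(2) topological_basis_open by blast
    show "\<exists>k. x \<in> from_nat_into A k \<and> from_nat_into A k \<subseteq> U" if "open U" "x \<in> U" for U x
    proof -
      obtain V where "V \<in> A" "x \<in> V" "V \<subseteq> U"
        using topological_basisE[OF A(2) \<open>open U\<close> \<open>x \<in> U\<close>] .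
      then show ?thesis using r by (metis imageE)
    qed
  qed
qed

text \<open>
  The code of a point records in which basic open sets it lies. Cover \<open>K\<close> by finitely many basic sets
  of diameter less than \<open>\<epsilon>\<close>; points whose codes agree on these finitely many digits lie
  in a common one of them.
\<close>

lemma basis_code_inverse_uniformly_continuous:
  fixes B :: "nat \<Rightarrow> 't::metric_space set"
  assumes B: "\<And>k. open (B k)" "\<And>U x. open U \<Longrightarrow> x \<in> U \<Longrightarrow> \<exists>k. x \<in> B k \<and> B k \<subseteq> U"
    and "compact K" "0 < \<epsilon>"
  shows "\<exists>\<delta>>0. \<forall>x\<in>K. \<forall>y\<in>K.
       \<bar>ternary_code (\<lambda>k. x \<in> B k) - ternary_code (\<lambda>k. y \<in> B k)\<bar> < \<delta> \<longrightarrow> dist x y < \<epsilon>"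
proof -
  define I where "I = {k. \<forall>x\<in>B k. \<forall>y\<in>B k. dist x y < \<epsilon>}"
  have "K \<subseteq> (\<Union>k\<in>I. B k)"
  proof
    fix x assume "x \<in> K"
    obtain k where k: "x \<in> B k" "B k \<subseteq> ball x (\<epsilon>/2)"
      using B(2)[of "ball x (\<epsilon>/2)" x] \<open>0 < \<epsilon>\<close> by auto
    have "dist y z < \<epsilon>" if "y \<in> B k" "z \<in> B k" for y z
    proof -
      have "dist x y < \<epsilon>/2" "dist x z < \<epsilon>/2" using k(2) that by auto
      then show ?thesis using dist_triangle3[of y z x] by linarith
    qed
    then have "k \<in> I" unfolding I_def by blast
    then show "x \<in> (\<Union>k\<in>I. B k)" using k by blast
  qed
  then obtain I' where I': "I' \<subseteq> I" "finite I'" "K \<subseteq> (\<Union>k\<in>I'. B k)"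
    using compactE_image[OF \<open>compact K\<close>, of I B] B(1) by metis
  obtain N where N: "\<And>k. k \<in> I' \<Longrightarrow> k < N"
    using I'(2) unfolding finite_nat_set_iff_bounded by blast
  show ?thesis
  proof (intro exI[of _ "(1/3) ^ N"] conjI ballI impI)
    fix x y assume xy: "x \<in> K" "y \<in> K"
      "\<bar>ternary_code (\<lambda>k. x \<in> B k) - ternary_code (\<lambda>k. y \<in> B k)\<bar> < (1/3) ^ N"
    obtain k where k: "k \<in> I'" "x \<in> B k" using I' xy by blast
    then have "y \<in> B k"
      using ternary_code_separates[OF xy(3) N] by blast
    then show "dist x y < \<epsilon>" using k I' unfolding I_def by blast
  qed simp
qed

text \<open>
  Measures are transported along the code \<open>s\<close>, which is measurable, and continuous functions along
  the decoding \<open>c\<close>. On a single compact \<open>K j\<close> the inverse of the basis code is uniformly continuous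
  with values in a complete set, so it extends to the closure of the codes. The integer part \<open>J\<close>
  separates the pieces, which makes this argument local.
\<close>

lemma sigma_compact_coding:
  fixes K :: "nat \<Rightarrow> 't::{metric_space, second_countable_topology} set"
  assumes K: "\<And>j. compact (K j)"
  shows "\<exists>s D (c :: real \<Rightarrow> 't). s \<in> borel_measurable borel \<and> (\<forall>j. bounded (s ` K j)) \<and>
    closed D \<and> continuous_on D c \<and> (\<forall>j. \<forall>x\<in>K j. s x \<in> D \<and> c (s x) = x)"
proof -
  obtain B :: "nat \<Rightarrow> 't set" where B: "\<And>k. open (B k)"
    "\<And>U x. open U \<Longrightarrow> x \<in> U \<Longrightarrow> \<exists>k. x \<in> B k \<and> B k \<subseteq> U"
    using countable_basis_sequence by blast
  define A where "A = (\<Union>j. K j)"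
  define J where "J x = (LEAST j. x \<in> K j)" for x
  define u where "u x = ternary_code (\<lambda>k. x \<in> B k)" for x
  \<comment> \<open>Since \<open>0 \<le> u x \<le> 3/2\<close>, the factor 3 keeps codes from different pieces at distance greater than 1.\<close>
  define s where "s x = 3 * real (J x) + u x" for x
  define D where "D = closure (s ` A)"
  have [measurable]: "K j \<in> sets borel" "B k \<in> sets borel" for j k
    using K B(1) by (auto intro: borel_closed compact_imp_closed)
  have [measurable]: "u \<in> borel_measurable borel"
    unfolding u_def by (rule borel_measurable_ternary_code) simp
  have [measurable]: "J \<in> borel \<rightarrow>\<^sub>M count_space UNIV"
    unfolding J_def by measurable
  have s_meas: "s \<in> borel_measurable borel"
    unfolding s_def by measurable
  have u: "0 \<le> u x" "u x \<le> 3/2" for x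
    unfolding u_def by (rule ternary_code_bounds)+
  have J: "x \<in> K (J x)" if "x \<in> A" for x
    using that unfolding J_def A_def by (auto intro: LeastI)
  have J_le: "J x \<le> j" if "x \<in> K j" for x j
    using that unfolding J_def by (rule Least_le)
  have bdd: "bounded (s ` K j)" for j
  proof -
    have "norm (s x) \<le> 3 * real j + 3/2" if "x \<in> K j" for x
      using J_le[OF that] u[of x] unfolding s_def by simp
    then show ?thesis unfolding bounded_iff by blast
  qed
  have same_J: "J x = J y" if "\<bar>s x - s y\<bar> < 1" for x y
  proof (rule ccontr)
    assume "J x \<noteq> J y"
    then have "real (J x) + 1 \<le> real (J y) \<or> real (J y) + 1 \<le> real (J x)" by linarith
    then show False using that u[of x] u[of y] unfolding s_def by linarith
  qed
  \<comment> \<open>\<open>lim_of t l\<close>: points of \<open>A\<close> converge to \<open>l\<close> as their codes converge to \<open>t\<close>.\<close>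
  define lim_of where "lim_of t l \<longleftrightarrow>
      (\<forall>\<epsilon>>0. \<exists>\<delta>>0. \<forall>x\<in>A. \<bar>s x - t\<bar> < \<delta> \<longrightarrow> dist x l < \<epsilon>)" for t l
  have approx: "\<exists>x\<in>A. \<bar>s x - t\<bar> < \<delta>" if "t \<in> D" "0 < \<delta>" for t \<delta>
    using that closure_approachable[of t "s ` A"] unfolding D_def dist_real_def by auto
  \<comment> \<open>Points with codes tending to \<open>t\<close> end up in one compact piece; any cluster point there is the limit.\<close>
  have ex: "\<exists>l. lim_of t l" if t: "t \<in> D" for t
  proof -
    have "\<forall>n. \<exists>x\<in>A. \<bar>s x - t\<bar> < inverse (real (Suc n)) / 2"
      by (intro allI approx[OF t]) simp
    then obtain x where x: "\<And>n. x n \<in> A" "\<And>n. \<bar>s (x n) - t\<bar> < inverse (real (Suc n)) / 2"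
      by metis
    define j where "j = J (x 0)"
    have J_eq: "J y = j" if "\<bar>s y - t\<bar> < 1/2" for y
      unfolding j_def using x(2)[of 0] that by (intro same_J) (simp add: abs_if split: if_splits)
    have half: "\<bar>s (x n) - t\<bar> < 1/2" for n
    proof -
      have "inverse (real (Suc n)) \<le> 1" by (simp add: field_simps)
      then show ?thesis using x(2)[of n] by linarith
    qed
    have xK: "x n \<in> K j" for n
      using J[OF x(1)[of n]] J_eq[OF half[of n]] by simp
    have "seq_compact (K j)" using K by (simp add: compact_eq_seq_compact_metric)
    then obtain l r where l: "l \<in> K j" "strict_mono (r :: nat \<Rightarrow> nat)" "(x \<circ> r) \<longlonglongrightarrow> l"
      using xK by (auto elim!: seq_compactE)
    have "lim_of t l"
      unfolding lim_of_def
    proof (intro allI impI)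
      fix \<epsilon> :: real assume "0 < \<epsilon>"
      then obtain \<delta> where \<delta>: "0 < \<delta>" "\<And>y z. y \<in> K j \<Longrightarrow> z \<in> K j \<Longrightarrow>
          \<bar>u y - u z\<bar> < \<delta> \<Longrightarrow> dist y z < \<epsilon>/2"
        using basis_code_inverse_uniformly_continuous[OF B K, of "\<epsilon>/2" j] unfolding u_def
        by auto
      have "dist y l < \<epsilon>" if y: "y \<in> A" "\<bar>s y - t\<bar> < min (\<delta>/2) (1/2)" for y
      proof -
        have "\<forall>\<^sub>F n in sequentially. dist ((x \<circ> r) n) l < \<epsilon>/2"
          using tendstoD[OF l(3), of "\<epsilon>/2"] \<open>0 < \<epsilon>\<close> by simp
        moreover have "\<forall>\<^sub>F n in sequentially. inverse (real (Suc n)) < \<delta>"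
          using order_tendstoD(2)[OF LIMSEQ_inverse_real_of_nat \<delta>(1)] .
        ultimately have "\<forall>\<^sub>F n in sequentially. dist (x (r n)) l < \<epsilon>/2 \<and> inverse (real (Suc n)) < \<delta>"
          by eventually_elim simp
        then obtain n where n: "dist (x (r n)) l < \<epsilon>/2" "inverse (real (Suc n)) < \<delta>"
          by (auto simp: eventually_sequentially)
        have "inverse (real (Suc (r n))) \<le> inverse (real (Suc n))"
          using seq_suble[OF l(2), of n] by (intro le_imp_inverse_le) auto
        then have close: "\<bar>s y - s (x (r n))\<bar> < \<delta>"
          using x(2)[of "r n"] y(2) n(2) by linarith
        have Jy: "J y = j" using y by (intro J_eq) simp
        have "y \<in> K j" using J[OF y(1)] Jy by simp
        moreover have "\<bar>u y - u (x (r n))\<bar> < \<delta>"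
          using close Jy J_eq[OF half[of "r n"]] unfolding s_def by simp
        ultimately have "dist y (x (r n)) < \<epsilon>/2" using \<delta>(2) xK by blast
        then show ?thesis using n(1) dist_triangle[of y l "x (r n)"] by linarith
      qed
      then show "\<exists>\<delta>>0. \<forall>x\<in>A. \<bar>s x - t\<bar> < \<delta> \<longrightarrow> dist x l < \<epsilon>"
        using \<delta>(1) by (intro exI[of _ "min (\<delta>/2) (1/2)"]) auto
    qed
    then show ?thesis ..
  qed
  define c where "c t = (SOME l. lim_of t l)" for t
  have c: "lim_of t (c t)" if "t \<in> D" for t
    unfolding c_def using ex[OF that] by (rule someI_ex)
  have sD: "s x \<in> D" if "x \<in> A" for x
    unfolding D_def using that closure_subset[of "s ` A"] by auto
  have cs: "c (s x) = x" if "x \<in> A" for x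
  proof -
    have "dist x (c (s x)) < \<epsilon>" if "0 < \<epsilon>" for \<epsilon>
      using c[OF sD[OF \<open>x \<in> A\<close>]] \<open>x \<in> A\<close> that unfolding lim_of_def by force
    then have "\<not> 0 < dist x (c (s x))" by (metis less_irrefl)
    then show ?thesis by simp
  qed
  have cont: "continuous_on D c"
    unfolding continuous_on_iff
  proof (intro ballI allI impI)
    fix t \<epsilon> :: real assume t: "t \<in> D" "0 < \<epsilon>"
    then obtain \<delta> where \<delta>: "0 < \<delta>" "\<And>x. x \<in> A \<Longrightarrow> \<bar>s x - t\<bar> < \<delta> \<Longrightarrow> dist x (c t) < \<epsilon>/2"
      using c[OF t(1)] half_gt_zero[OF t(2)] unfolding lim_of_def by blast
    have "dist (c t') (c t) < \<epsilon>" if t': "t' \<in> D" "dist t' t < \<delta>/2" for t'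
    proof -
      obtain \<delta>' where \<delta>': "0 < \<delta>'" "\<And>x. x \<in> A \<Longrightarrow> \<bar>s x - t'\<bar> < \<delta>' \<Longrightarrow> dist x (c t') < \<epsilon>/2"
        using c[OF t'(1)] half_gt_zero[OF t(2)] unfolding lim_of_def by blast
      obtain x where x: "x \<in> A" "\<bar>s x - t'\<bar> < min (\<delta>/2) \<delta>'"
        using approx[OF t'(1), of "min (\<delta>/2) \<delta>'"] \<delta>(1) \<delta>'(1) by auto
      have "dist x (c t) < \<epsilon>/2"
        using x(2) t'(2) unfolding dist_real_def by (intro \<delta>(2)[OF x(1)]) linarith
      moreover have "dist x (c t') < \<epsilon>/2" using x by (intro \<delta>'(2)) auto
      ultimately show ?thesis using dist_triangle3[of "c t'" "c t" x] by linarith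
    qed
    then show "\<exists>d>0. \<forall>t'\<in>D. dist t' t < d \<longrightarrow> dist (c t') (c t) < \<epsilon>"
      using \<delta>(1) by (intro exI[of _ "\<delta>/2"]) auto
  qed
  have "s x \<in> D \<and> c (s x) = x" if "x \<in> K j" for x j
    using that sD cs unfolding A_def by blast
  then show ?thesis
    using s_meas bdd cont unfolding D_def
    by (intro exI[of _ s] exI[of _ "closure (s ` A)"] exI[of _ c]) auto
qed

section \<open>Weak limits of tight sequences\<close>

text \<open>
  Test the convergence with the bounded continuous function \<open>min 1 (infdist t D)\<close>, which vanishes
  exactly on \<open>D\<close>.
\<close>

lemma weak_limit_concentrates_on_closed:
  assumes \<mu>: "\<And>n. real_distribution (\<mu> n)" and M: "real_distribution M"
    and conv: "weak_conv_m \<mu> M"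
    and D: "closed D" "D \<noteq> {}" "\<And>n. AE t in \<mu> n. t \<in> D"
  shows "AE t in M. t \<in> D"
proof -
  interpret M: real_distribution M by fact
  define g where "g t = min 1 (infdist t D)" for t :: real
  have g: "0 \<le> g t" "g t \<le> 1" for t
    unfolding g_def using infdist_nonneg[of t D] by auto
  have g_cont: "continuous_on UNIV g"
    unfolding g_def by (intro continuous_intros)
  then have [measurable]: "g \<in> borel_measurable borel"
    by (rule borel_measurable_continuous_onI)
  have "(\<lambda>n. integral\<^sup>L (\<mu> n) g) \<longlonglongrightarrow> integral\<^sup>L M g"
    using g_cont g
    by (intro weak_conv_imp_integral_bdd_continuous_conv[OF \<mu> M conv, where B=1])
       (auto simp: continuous_on_eq_continuous_at)
  moreover have "integral\<^sup>L (\<mu> n) g = 0" for n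
    using D(3)[of n] unfolding g_def by (intro integral_eq_zero_AE) auto
  ultimately have "integral\<^sup>L M g = 0"
    by (simp add: LIMSEQ_const_iff)
  moreover have "integrable M g"
    using g by (intro M.integrable_const_bound[where B=1]) auto
  ultimately have "AE t in M. g t = 0"
    using g integral_nonneg_eq_0_iff_AE[of M g] by auto
  then show ?thesis
  proof eventually_elim
    case (elim t)
    then have "infdist t D = 0"
      unfolding g_def by (simp add: min_def split: if_splits)
    then show ?case
      using D by (simp add: in_closed_iff_infdist_zero)
  qed
qed

lemma borel_prob_spaceD:
  assumes "borel_prob F"
  shows "prob_space F" "sets F = sets borel" "space F = UNIV"
  using assms sets_eq_imp_space_eq[of F borel] unfolding borel_prob_def by auto

text \<open>
  Push the measures forward by the code \<open>s\<close>; compact sets have bounded codes, so tightness survives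
  and the Helly selection theorem yields a weak limit \<open>M\<close> on the real line. It lives on the
  closed set \<open>D\<close> where the decoding map \<open>c\<close> is continuous, and its image under \<open>c\<close> is the limit: for
  bounded continuous \<open>f\<close>, the Tietze extension of \<open>f \<circ> c\<close> is a test function on the real line.
\<close>

theorem tight_imp_weakly_convergent_subsequence:
  fixes Fn :: "nat \<Rightarrow> 't::{metric_space, second_countable_topology} measure"
  assumes prob: "\<And>n. borel_prob (Fn n)"
    and tight: "\<And>\<epsilon>. 0 < \<epsilon> \<Longrightarrow> \<exists>K. compact K \<and> (\<forall>n. 1 - \<epsilon> < measure (Fn n) K)"
  shows "\<exists>r G. strict_mono (r :: nat \<Rightarrow> nat) \<and> borel_prob G \<and> tendsto_weakly (\<lambda>n. Fn (r n)) G"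
proof -
  note [simp, measurable_cong] = borel_prob_spaceD(2)[OF prob]
  interpret F: prob_space "Fn n" for n by (rule borel_prob_spaceD(1)[OF prob])
  have space [simp]: "space (Fn n) = UNIV" for n by (rule borel_prob_spaceD(3)[OF prob])
  have "\<forall>j. \<exists>K. compact K \<and> (\<forall>n. 1 - inverse (real (Suc j)) < measure (Fn n) K)"
    using tight by simp
  then obtain K where K: "\<And>j. compact (K j)"
    "\<And>j n. 1 - inverse (real (Suc j)) < measure (Fn n) (K j)"
    by metis
  have [measurable]: "K j \<in> sets borel" for j
    using K by (auto intro: borel_closed compact_imp_closed)
  obtain s D and c :: "real \<Rightarrow> 't" where s [measurable]: "s \<in> borel_measurable borel"
    and s_bdd: "\<And>j. bounded (s ` K j)" and D: "closed D" and c: "continuous_on D c"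
    and cs: "\<And>x j. x \<in> K j \<Longrightarrow> s x \<in> D \<and> c (s x) = x"
    using sigma_compact_coding[of K, OF K(1)] by blast
  have [measurable]: "D \<in> sets borel" using D by (rule borel_closed)
  have AE_K: "AE x in Fn n. x \<in> (\<Union>j. K j)" for n
  proof -
    have "1 - inverse (real (Suc j)) \<le> measure (Fn n) (\<Union>j. K j)" for j
      using K(2)[of j n] F.finite_measure_mono[of "K j" "\<Union>j. K j" n] by force
    moreover have "(\<lambda>j. 1 - inverse (real (Suc j))) \<longlonglongrightarrow> 1 - 0"
      by (intro tendsto_intros LIMSEQ_inverse_real_of_nat)
    ultimately have "1 \<le> measure (Fn n) (\<Union>j. K j)"
      by (intro LIMSEQ_le_const2[where x=1]) auto
    then have "F.prob n (\<Union>j. K j) = 1"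
      using F.prob_le_1 by (intro antisym) auto
    then show ?thesis
      using F.prob_eq_1[of "\<Union>j. K j" n] by simp
  qed
  have AE_sD: "AE x in Fn n. s x \<in> D \<and> c (s x) = x" for n
    using AE_K[of n] by eventually_elim (use cs in blast)
  define \<mu> where "\<mu> n = distr (Fn n) borel s" for n
  have \<mu>: "real_distribution (\<mu> n)" for n
    unfolding \<mu>_def by (intro F.real_distribution_distr) simp
  have \<mu>_tight: "Helly_Selection.tight \<mu>"
    unfolding tight_def
  proof (intro conjI allI impI \<mu>)
    fix \<epsilon> :: real assume "0 < \<epsilon>"
    then obtain j where j: "inverse (real (Suc j)) < \<epsilon>" using reals_Archimedean by blast
    obtain b where b: "0 < b" "\<And>x. x \<in> K j \<Longrightarrow> \<bar>s x\<bar> < b"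
      using s_bdd[of j] unfolding bounded_pos_less by auto
    have "1 - \<epsilon> < measure (\<mu> n) {-b<..b}" for n
    proof -
      have "s -` {-b<..b} \<in> sets (Fn n)"
        using measurable_sets[OF s, of "{-b<..b}"] by simp
      moreover have "K j \<subseteq> s -` {-b<..b}"
        using b(2) by force
      ultimately have *: "measure (Fn n) (K j) \<le> measure (Fn n) (s -` {-b<..b})"
        by (rule F.finite_measure_mono[rotated])
      have "1 - \<epsilon> < measure (Fn n) (K j)" using K(2)[of j n] j by linarith
      also have "\<dots> \<le> measure (Fn n) (s -` {-b<..b})"
        by (rule *)
      also have "\<dots> = measure (\<mu> n) {-b<..b}"
        unfolding \<mu>_def by (simp add: measure_distr)
      finally show ?thesis .
    qed
    then show "\<exists>a b. a < b \<and> (\<forall>n. 1 - \<epsilon> < measure (\<mu> n) {a<..b})"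
      using b(1) by (intro exI[of _ "-b"] exI[of _ b]) auto
  qed
  obtain r M where r: "strict_mono (r :: nat \<Rightarrow> nat)" and M: "real_distribution M"
    and "weak_conv_m (\<mu> \<circ> id \<circ> r) M"
    using tight_imp_convergent_subsubsequence[OF \<mu>_tight, of id] by (auto simp: strict_mono_def)
  then have conv: "weak_conv_m (\<lambda>n. \<mu> (r n)) M" by (simp add: comp_def)
  interpret M: real_distribution M by fact
  have "K 0 \<noteq> {}" using K(2)[of 0 0] by auto
  then have "D \<noteq> {}" using cs by blast
  have AE_D: "AE t in M. t \<in> D"
  proof (rule weak_limit_concentrates_on_closed[OF \<mu> M conv D \<open>D \<noteq> {}\<close>])
    show "AE t in \<mu> (r n). t \<in> D" for n
      unfolding \<mu>_def using AE_sD[of "r n"] by (subst AE_distr_iff) auto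
  qed
  define c' where "c' t = (if t \<in> D then c t else undefined)" for t
  have [measurable]: "c' \<in> borel \<rightarrow>\<^sub>M borel"
    unfolding c'_def
    by (subst measurable_If_restrict_space_iff)
       (use borel_measurable_continuous_on_restrict[OF c] in auto)
  define G where "G = distr M borel c'"
  have G: "borel_prob G"
    unfolding borel_prob_def G_def by (simp add: M.prob_space_distr)
  have "(\<lambda>n. \<integral>x. f x \<partial>Fn (r n)) \<longlonglongrightarrow> (\<integral>x. f x \<partial>G)"
    if f: "continuous_on UNIV f" "bounded (range f)" for f :: "'t \<Rightarrow> real"
  proof -
    have [measurable]: "f \<in> borel_measurable borel"
      using f(1) by (rule borel_measurable_continuous_onI)
    obtain C where C: "0 \<le> C" "\<And>x. norm (f x) \<le> C"
      using f(2) unfolding bounded_pos by (auto intro: less_imp_le)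
    have "continuous_on D (\<lambda>t. f (c t))"
      by (rule continuous_on_compose2[OF f(1) c]) simp
    then obtain h where h: "continuous_on UNIV h" "\<And>t. t \<in> D \<Longrightarrow> h t = f (c t)"
      "\<And>t. norm (h t) \<le> C"
      using Tietze[of D "\<lambda>t. f (c t)" UNIV C] D C by auto
    have [measurable]: "h \<in> borel_measurable borel"
      using h(1) by (rule borel_measurable_continuous_onI)
    have "(\<lambda>n. integral\<^sup>L (\<mu> (r n)) h) \<longlonglongrightarrow> integral\<^sup>L M h"
      using h by (intro weak_conv_imp_integral_bdd_continuous_conv[OF \<mu> M conv, where B=C])
        (auto simp: continuous_on_eq_continuous_at)
    moreover have "integral\<^sup>L (\<mu> n) h = (\<integral>x. f x \<partial>Fn n)" for n
    proof -
      have "integral\<^sup>L (\<mu> n) h = (\<integral>x. h (s x) \<partial>Fn n)"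
        unfolding \<mu>_def by (rule integral_distr) simp_all
      also have "\<dots> = (\<integral>x. f x \<partial>Fn n)"
        by (rule integral_cong_AE) (use AE_sD[of n] h(2) in auto)
      finally show ?thesis .
    qed
    moreover have "integral\<^sup>L M h = (\<integral>x. f x \<partial>G)"
    proof -
      have "integral\<^sup>L M h = (\<integral>t. f (c' t) \<partial>M)"
      proof (rule integral_cong_AE)
        show "AE t in M. h t = f (c' t)"
          using AE_D by eventually_elim (simp add: h(2) c'_def)
      qed measurable
      also have "\<dots> = (\<integral>x. f x \<partial>G)"
        unfolding G_def by (rule integral_distr[symmetric]) simp_all
      finally show ?thesis .
    qed
    ultimately show ?thesis by simp
  qed
  then show ?thesis
    using r G unfolding tendsto_weakly_def by blast
qed

section \<open>Joint measurability and subsequences\<close>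

text \<open>
  With \<open>e\<close> enumerating a dense set, replace \<open>\<theta>\<close> by the first \<open>e k\<close> within distance \<open>1/(N+1)\<close>. This
  choice is measurable with countably many values, so the resulting functions are jointly measurable, and
  by continuity in \<open>\<theta>\<close> they converge to \<open>p\<close> pointwise.
\<close>

lemma caratheodory_measurable:
  fixes p :: "'x \<Rightarrow> 't::{metric_space, second_countable_topology} \<Rightarrow> real"
  assumes meas: "\<And>\<theta>. (\<lambda>x. p x \<theta>) \<in> borel_measurable M"
    and cont: "\<And>x. x \<in> space M \<Longrightarrow> continuous_on UNIV (p x)"
  shows "case_prod p \<in> borel_measurable (M \<Otimes>\<^sub>M borel)"
proof -
  obtain D :: "'t set" where D: "countable D" "\<And>X. open X \<Longrightarrow> X \<noteq> {} \<Longrightarrow> \<exists>d\<in>D. d \<in> X"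
    by (rule countable_dense_setE) blast
  have "D \<noteq> {}" using D(2)[of UNIV] by auto
  define e where "e = from_nat_into D"
  have e: "\<exists>k. dist (e k) \<theta> < inverse (real (Suc N))" for \<theta> N
  proof -
    obtain d where "d \<in> D" "d \<in> ball \<theta> (inverse (real (Suc N)))"
      using D(2)[of "ball \<theta> (inverse (real (Suc N)))"] by auto
    moreover from \<open>d \<in> D\<close> obtain k where "e k = d"
      using from_nat_into_surj[OF D(1)] unfolding e_def by blast
    ultimately show ?thesis by (auto simp: dist_commute)
  qed
  define k where "k N \<theta> = (LEAST k. dist (e k) \<theta> < inverse (real (Suc N)))" for N \<theta>
  have k: "dist (e (k N \<theta>)) \<theta> < inverse (real (Suc N))" for N \<theta>
    unfolding k_def by (rule LeastI_ex[OF e])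
  have [measurable]: "k N \<in> borel \<rightarrow>\<^sub>M count_space UNIV" for N
    unfolding k_def by measurable
  have "(\<lambda>z. p (fst z) (e (k N (snd z)))) \<in> borel_measurable (M \<Otimes>\<^sub>M borel)" for N
  proof (rule measurable_compose_countable[where f = "\<lambda>i z. p (fst z) (e i)"])
    show "(\<lambda>z. p (fst z) (e i)) \<in> borel_measurable (M \<Otimes>\<^sub>M borel)" for i
      by (rule measurable_compose[OF measurable_fst meas])
  qed simp
  moreover have "(\<lambda>N. p (fst z) (e (k N (snd z)))) \<longlonglongrightarrow> case_prod p z"
    if "z \<in> space (M \<Otimes>\<^sub>M borel)" for z
  proof -
    have "(\<lambda>N. dist (e (k N (snd z))) (snd z)) \<longlonglongrightarrow> 0"
      by (rule tendsto_sandwich[OF _ _ tendsto_const LIMSEQ_inverse_real_of_nat])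
         (auto intro!: always_eventually less_imp_le[OF k] simp del: of_nat_Suc)
    then have "(\<lambda>N. e (k N (snd z))) \<longlonglongrightarrow> snd z"
      by (rule iffD2[OF tendsto_dist_iff])
    moreover have "fst z \<in> space M" using that by (auto simp: space_pair_measure)
    ultimately show ?thesis
      using continuous_on_tendsto_compose[OF cont] by (auto simp: split_beta)
  qed
  ultimately show ?thesis by (rule borel_measurable_LIMSEQ_real[rotated])
qed

lemma LIMSEQ_if_subseqs_have_convergent_subseq:
  fixes a :: "nat \<Rightarrow> 'a::metric_space"
  assumes "\<And>r :: nat \<Rightarrow> nat. strict_mono r \<Longrightarrow> \<exists>r'. strict_mono (r' :: nat \<Rightarrow> nat) \<and> (\<lambda>n. a (r (r' n))) \<longlonglongrightarrow> L"
  shows "a \<longlonglongrightarrow> L"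
proof (rule ccontr)
  assume "\<not> a \<longlonglongrightarrow> L"
  then obtain \<epsilon> where "\<epsilon> > 0" and "infinite {n. \<not> dist (a n) L < \<epsilon>}"
    by (auto simp: tendsto_iff not_eventually INFM_iff_infinite cofinite_eq_sequentially[symmetric])
  then obtain r :: "nat \<Rightarrow> nat" where r: "\<And>n. \<not> dist (a (r n)) L < \<epsilon>" and "strict_mono r"
    using infinite_enumerate by blast
  then obtain r' where "(\<lambda>n. a (r (r' n))) \<longlonglongrightarrow> L" using assms by blast
  then show False
    using r \<open>\<epsilon> > 0\<close> by (auto dest: tendstoD)
qed

section \<open>Tightness of densities on a Polish space\<close>

text \<open>
  This is inner regularity of finite Borel measures on a Polish space.
\<close>

lemma density_concentrates_on_compact:
  fixes \<nu> :: "'x::polish_space measure"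
  assumes \<nu>: "sets \<nu> = sets borel" and q: "density_wrt \<nu> q" and "0 < \<epsilon>"
  shows "\<exists>K. compact K \<and> ennreal (1 - \<epsilon>) < (\<integral>\<^sup>+x. ennreal (q x) * indicator K x \<partial>\<nu>)"
proof -
  note [measurable_cong] = \<nu>
  have [measurable]: "q \<in> borel_measurable \<nu>" using q unfolding density_wrt_def by blast
  define \<mu> where "\<mu> = density \<nu> (\<lambda>x. ennreal (q x))"
  have sets: "sets \<mu> = sets borel" unfolding \<mu>_def using \<nu> by simp
  have space: "space \<mu> = UNIV" using sets_eq_imp_space_eq[OF sets] by simp
  have "emeasure \<mu> (space \<mu>) = (\<integral>\<^sup>+x. ennreal (q x) * indicator (space \<nu>) x \<partial>\<nu>)"
    unfolding \<mu>_def by (simp add: emeasure_density)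
  also have "\<dots> = (\<integral>\<^sup>+x. ennreal (q x) \<partial>\<nu>)"
    by (rule nn_integral_cong) simp
  finally have one: "emeasure \<mu> UNIV = 1" using q space unfolding density_wrt_def by simp
  have "emeasure \<mu> UNIV = (SUP K \<in> {K. K \<subseteq> UNIV \<and> compact K}. emeasure \<mu> K)"
    by (rule inner_regular[OF sets]) (use one space in auto)
  moreover have "ennreal (1 - \<epsilon>) < 1"
    using ennreal_lessI[of 1 "1 - \<epsilon>"] \<open>0 < \<epsilon>\<close> by simp
  ultimately have "ennreal (1 - \<epsilon>) < (SUP K \<in> {K. K \<subseteq> UNIV \<and> compact K}. emeasure \<mu> K)"
    using one by simp
  then obtain K where K: "compact K" "ennreal (1 - \<epsilon>) < emeasure \<mu> K"
    unfolding less_SUP_iff by blast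
  have "K \<in> sets \<nu>" using K(1) \<nu> by (simp add: borel_closed compact_imp_closed)
  then show ?thesis
    using K unfolding \<mu>_def by (auto simp: emeasure_density)
qed

text \<open>
  A compact set carrying most of the limit \<open>h\<close> carries most of \<open>g n\<close> for all large \<open>n\<close>; the finitely many
  remaining densities each contribute a compact set of their own.
\<close>

lemma L1_convergent_densities_tight:
  fixes \<nu> :: "'x::polish_space measure"
  assumes \<nu>: "sets \<nu> = sets borel" and g: "\<And>n. density_wrt \<nu> (g n)" and h: "density_wrt \<nu> h"
    and L1: "tendsto_L1 \<nu> g h" and \<epsilon>: "0 < \<epsilon>" "\<epsilon> < 1"
  shows "\<exists>K. compact K \<and> (\<forall>n. ennreal (1 - \<epsilon>) < (\<integral>\<^sup>+x. ennreal (g n x) * indicator K x \<partial>\<nu>))"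
proof -
  have [measurable]: "g n \<in> borel_measurable \<nu>" "h \<in> borel_measurable \<nu>" for n
    using g h unfolding density_wrt_def by blast+
  have nonneg: "0 \<le> g n x" "0 \<le> h x" for n x
    using g h unfolding density_wrt_def by blast+
  have [measurable]: "K \<in> sets \<nu>" if "compact K" for K
    using that \<nu> by (simp add: borel_closed compact_imp_closed)
  obtain K0 where K0: "compact K0"
    "ennreal (1 - \<epsilon>/2) < (\<integral>\<^sup>+x. ennreal (h x) * indicator K0 x \<partial>\<nu>)"
    using density_concentrates_on_compact[OF \<nu> h, of "\<epsilon>/2"] \<epsilon> by auto
  have "\<forall>n. \<exists>K. compact K \<and> ennreal (1 - \<epsilon>) < (\<integral>\<^sup>+x. ennreal (g n x) * indicator K x \<partial>\<nu>)"
    using density_concentrates_on_compact[OF \<nu> g \<epsilon>(1)] by blast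
  then obtain K where K: "\<And>n. compact (K n)"
    "\<And>n. ennreal (1 - \<epsilon>) < (\<integral>\<^sup>+x. ennreal (g n x) * indicator (K n) x \<partial>\<nu>)"
    by metis
  have "\<forall>\<^sub>F n in sequentially. (\<integral>\<^sup>+x. ennreal \<bar>g n x - h x\<bar> \<partial>\<nu>) < ennreal (\<epsilon>/2)"
    using L1 \<epsilon> unfolding tendsto_L1_def by (intro order_tendstoD(2)) auto
  then obtain N where N: "\<And>n. N \<le> n \<Longrightarrow> (\<integral>\<^sup>+x. ennreal \<bar>g n x - h x\<bar> \<partial>\<nu>) < ennreal (\<epsilon>/2)"
    unfolding eventually_sequentially by blast
  have late: "ennreal (1 - \<epsilon>) < (\<integral>\<^sup>+x. ennreal (g n x) * indicator K0 x \<partial>\<nu>)" (is "_ < ?a")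
    if "N \<le> n" for n
  proof (rule ccontr)
    assume "\<not> ennreal (1 - \<epsilon>) < ?a"
    then have a: "?a \<le> ennreal (1 - \<epsilon>)" by simp
    have [measurable]: "K0 \<in> sets \<nu>" using K0 \<open>\<And>K. compact K \<Longrightarrow> K \<in> sets \<nu>\<close> by blast
    have pt: "ennreal (h x) * indicator K0 x
        \<le> ennreal (g n x) * indicator K0 x + ennreal \<bar>g n x - h x\<bar>" for x
    proof -
      have "ennreal (h x) \<le> ennreal (g n x + \<bar>g n x - h x\<bar>)" by (intro ennreal_leI) auto
      also have "\<dots> = ennreal (g n x) + ennreal \<bar>g n x - h x\<bar>" using nonneg by simp
      finally show ?thesis by (simp split: split_indicator)
    qed
    have "(\<integral>\<^sup>+x. ennreal (h x) * indicator K0 x \<partial>\<nu>)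
        \<le> (\<integral>\<^sup>+x. ennreal (g n x) * indicator K0 x + ennreal \<bar>g n x - h x\<bar> \<partial>\<nu>)"
      using pt by (rule nn_integral_mono)
    also have "\<dots> = ?a + (\<integral>\<^sup>+x. ennreal \<bar>g n x - h x\<bar> \<partial>\<nu>)"
      by (rule nn_integral_add) measurable
    also have "\<dots> \<le> ennreal (1 - \<epsilon>) + ennreal (\<epsilon>/2)"
      using a N[OF that] by (intro add_mono) auto
    also have "\<dots> = ennreal (1 - \<epsilon>/2)"
      using \<epsilon> by (simp flip: ennreal_plus)
    finally show False using K0(2) by simp
  qed
  define T where "T = K0 \<union> (\<Union>n<N. K n)"
  have "compact T"
    unfolding T_def using K0 K by (intro compact_Un compact_UN) auto
  moreover have "ennreal (1 - \<epsilon>) < (\<integral>\<^sup>+x. ennreal (g n x) * indicator T x \<partial>\<nu>)" for n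
  proof -
    have mono: "(\<integral>\<^sup>+x. ennreal (g n x) * indicator A x \<partial>\<nu>) \<le> (\<integral>\<^sup>+x. ennreal (g n x) * indicator T x \<partial>\<nu>)"
      if "A \<subseteq> T" for A
      using that by (intro nn_integral_mono mult_left_mono) (auto split: split_indicator)
    show ?thesis
    proof (cases "N \<le> n")
      case True
      have "K0 \<subseteq> T" unfolding T_def by blast
      then show ?thesis using late[OF True] mono by (meson less_le_trans)
    next
      case False
      then have "K n \<subseteq> T" unfolding T_def by auto
      then show ?thesis using K(2)[of n] mono by (meson less_le_trans)
    qed
  qed
  ultimately show ?thesis by blast
qed

section \<open>Mixtures of a sampling density\<close>

locale sampling_model = sigma_finite_measure \<nu>
  for \<nu> :: "'x::polish_space measure" +
  fixes p :: "'x \<Rightarrow> 't::{metric_space, second_countable_topology} \<Rightarrow> real"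
  assumes sets_\<nu> [simp, measurable_cong]: "sets \<nu> = sets borel"
    and sampling_density: "\<And>\<theta>. density_wrt \<nu> (\<lambda>x. p x \<theta>)"
    and bounded_p: "\<And>x. bounded (range (p x))"
    and continuous_p: "\<And>x. continuous_on UNIV (p x)"
begin

lemma p_nonneg: "0 \<le> p x \<theta>"
  and p_measurable [measurable]: "(\<lambda>x. p x \<theta>) \<in> borel_measurable \<nu>"
  and nn_integral_p: "(\<integral>\<^sup>+x. ennreal (p x \<theta>) \<partial>\<nu>) = 1"
  using sampling_density[of \<theta>] unfolding density_wrt_def by blast+

lemma p_jointly_measurable: "case_prod p \<in> borel_measurable (\<nu> \<Otimes>\<^sub>M borel)"
  using continuous_p by (intro caratheodory_measurable) auto

context
  fixes F :: "'t measure"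
  assumes F: "borel_prob F"
begin

interpretation F: prob_space F by (rule borel_prob_spaceD(1)[OF F])

interpretation pair_sigma_finite \<nu> F ..

lemma p_jointly_measurable_prob: "case_prod p \<in> borel_measurable (\<nu> \<Otimes>\<^sub>M F)"
  using p_jointly_measurable borel_prob_spaceD(2)[OF F]
  by (simp cong: measurable_cong_sets sets_pair_measure_cong)

lemma integrable_p: "integrable F (p x)"
proof -
  obtain B where "\<And>\<theta>. norm (p x \<theta>) \<le> B"
    using bounded_p[of x] unfolding bounded_iff by blast
  moreover have "p x \<in> borel_measurable F"
    using borel_measurable_continuous_onI[OF continuous_p[of x]] borel_prob_spaceD(2)[OF F]
    by (simp cong: measurable_cong_sets)
  ultimately show ?thesis by (intro F.integrable_const_bound[where B=B]) auto
qed

lemma mixture_nonneg: "0 \<le> mixture p F x"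
  unfolding mixture_def by (simp add: p_nonneg)

lemma mixture_measurable: "mixture p F \<in> borel_measurable \<nu>"
  unfolding mixture_def using p_jointly_measurable_prob
  by (intro F.borel_measurable_lebesgue_integral) (simp add: case_prod_eta)

lemma nn_integral_mixture:
  assumes A [measurable]: "A \<in> sets \<nu>"
  shows "(\<integral>\<^sup>+x. ennreal (mixture p F x) * indicator A x \<partial>\<nu>) =
    (\<integral>\<^sup>+\<theta>. (\<integral>\<^sup>+x. ennreal (p x \<theta>) * indicator A x \<partial>\<nu>) \<partial>F)"
proof -
  note [measurable] = p_jointly_measurable_prob
  have "ennreal (mixture p F x) = (\<integral>\<^sup>+\<theta>. ennreal (p x \<theta>) \<partial>F)" for x
    unfolding mixture_def
    by (rule nn_integral_eq_integral[symmetric]) (auto simp: integrable_p p_nonneg)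
  then have "(\<integral>\<^sup>+x. ennreal (mixture p F x) * indicator A x \<partial>\<nu>) =
      (\<integral>\<^sup>+x. (\<integral>\<^sup>+\<theta>. ennreal (p x \<theta>) * indicator A x \<partial>F) \<partial>\<nu>)"
    using integrable_p by (intro nn_integral_cong) (simp add: nn_integral_multc)
  also have "\<dots> = (\<integral>\<^sup>+\<theta>. (\<integral>\<^sup>+x. ennreal (p x \<theta>) * indicator A x \<partial>\<nu>) \<partial>F)"
    by (rule Fubini'[symmetric]) measurable
  finally show ?thesis .
qed

lemma density_mixture: "density_wrt \<nu> (mixture p F)"
proof -
  have "(\<integral>\<^sup>+x. ennreal (mixture p F x) \<partial>\<nu>) = (\<integral>\<^sup>+x. ennreal (mixture p F x) * indicator (space \<nu>) x \<partial>\<nu>)"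
    by (rule nn_integral_cong) simp
  also have "\<dots> = (\<integral>\<^sup>+\<theta>. (\<integral>\<^sup>+x. ennreal (p x \<theta>) * indicator (space \<nu>) x \<partial>\<nu>) \<partial>F)"
    by (rule nn_integral_mixture) (rule sets.top)
  also have "\<dots> = (\<integral>\<^sup>+\<theta>. (\<integral>\<^sup>+x. ennreal (p x \<theta>) \<partial>\<nu>) \<partial>F)"
    by (intro nn_integral_cong) simp
  also have "\<dots> = 1" by (simp add: nn_integral_p F.emeasure_space_1)
  finally show ?thesis
    unfolding density_wrt_def using mixture_measurable mixture_nonneg by blast
qed

lemma integrable_mixture: "integrable \<nu> (mixture p F)"
  using density_mixture unfolding density_wrt_def by (intro integrableI_nonneg) auto

text \<open>
  The mass of \<open>X\<close> under the kernel is at most one on \<open>T\<close> and less than \<open>\<epsilon>\<close> off \<open>T\<close>; average this over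
  the mixing measure.
\<close>

lemma mixture_mass_le_mixing_mass:
  assumes X: "compact X" and T: "compact T" and "0 \<le> \<epsilon>"
    and small: "\<And>\<theta>. \<theta> \<notin> T \<Longrightarrow> (LINT x:X|\<nu>. p x \<theta>) < \<epsilon>"
  shows "(\<integral>\<^sup>+x. ennreal (mixture p F x) * indicator X x \<partial>\<nu>) \<le> ennreal (measure F T + \<epsilon>)"
proof -
  have [measurable]: "X \<in> sets \<nu>" using X by (simp add: borel_closed compact_imp_closed)
  have T_sets: "T \<in> sets F"
    using T borel_prob_spaceD(2)[OF F] by (simp add: borel_closed compact_imp_closed)
  have inner: "(\<integral>\<^sup>+x. ennreal (p x \<theta>) * indicator X x \<partial>\<nu>) \<le> indicator T \<theta> + ennreal \<epsilon>"
    (is "?I \<le> _") for \<theta>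
  proof (cases "\<theta> \<in> T")
    case True
    have "?I \<le> (\<integral>\<^sup>+x. ennreal (p x \<theta>) \<partial>\<nu>)"
      by (intro nn_integral_mono) (simp split: split_indicator)
    then show ?thesis using True by (simp add: nn_integral_p add_increasing2)
  next
    case False
    have "integrable \<nu> (\<lambda>x. p x \<theta>)"
      by (intro integrableI_nonneg) (auto simp: p_nonneg nn_integral_p)
    then have "integrable \<nu> (\<lambda>x. indicator X x *\<^sub>R p x \<theta>)"
      by (rule integrable_mult_indicator[OF \<open>X \<in> sets \<nu>\<close>])
    then have "(\<integral>\<^sup>+x. ennreal (indicator X x *\<^sub>R p x \<theta>) \<partial>\<nu>) = ennreal (LINT x:X|\<nu>. p x \<theta>)"
      unfolding set_lebesgue_integral_def
      by (intro nn_integral_eq_integral) (auto simp: p_nonneg)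
    moreover have "?I = (\<integral>\<^sup>+x. ennreal (indicator X x *\<^sub>R p x \<theta>) \<partial>\<nu>)"
      by (intro nn_integral_cong) (simp split: split_indicator)
    ultimately show ?thesis
      using False small[OF False] by (simp add: ennreal_leI)
  qed
  have "(\<integral>\<^sup>+x. ennreal (mixture p F x) * indicator X x \<partial>\<nu>) \<le> (\<integral>\<^sup>+\<theta>. indicator T \<theta> + ennreal \<epsilon> \<partial>F)"
    unfolding nn_integral_mixture[OF \<open>X \<in> sets \<nu>\<close>] by (intro nn_integral_mono inner)
  also have "\<dots> = emeasure F T + ennreal \<epsilon>"
    using T_sets by (simp add: nn_integral_add F.emeasure_space_1)
  also have "\<dots> = ennreal (measure F T + \<epsilon>)"
    using \<open>0 \<le> \<epsilon>\<close> by (simp add: F.emeasure_eq_measure)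
  finally show ?thesis .
qed

end

text \<open>
  If nearly all of the mixture mass sits on a compact \<open>X\<close>, mixing mass far out in the parameter
  space would be lost, because kernels with such parameters hardly charge \<open>X\<close>.
\<close>

lemma mixing_measures_tight:
  assumes F: "borel_prob F" and Fn: "\<And>n. borel_prob (Fn n)"
    and L1: "tendsto_L1 \<nu> (\<lambda>n. mixture p (Fn n)) (mixture p F)"
    and vanish: "\<And>\<epsilon> X0. 0 < \<epsilon> \<Longrightarrow> compact X0 \<Longrightarrow>
               \<exists>T0. compact T0 \<and> (\<forall>\<theta>. \<theta> \<notin> T0 \<longrightarrow> (LINT x:X0|\<nu>. p x \<theta>) < \<epsilon>)"
    and "0 < \<epsilon>"
  shows "\<exists>T. compact T \<and> (\<forall>n. 1 - \<epsilon> < measure (Fn n) T)"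
proof -
  \<comment> \<open>One \<open>\<delta>\<close> is lost to the mixture mass off \<open>X\<close>, one to the kernels with parameters off \<open>T\<close>.\<close>
  define \<delta> where "\<delta> = min (\<epsilon>/2) (1/2)"
  have \<delta>: "0 < \<delta>" "\<delta> < 1" "2 * \<delta> \<le> \<epsilon>" using \<open>0 < \<epsilon>\<close> unfolding \<delta>_def by auto
  obtain X where X: "compact X"
    "\<And>n. ennreal (1 - \<delta>) < (\<integral>\<^sup>+x. ennreal (mixture p (Fn n) x) * indicator X x \<partial>\<nu>)"
    using L1_convergent_densities_tight[OF sets_\<nu> density_mixture[OF Fn] density_mixture[OF F] L1 \<delta>(1,2)]
    by blast
  obtain T where T: "compact T" "\<And>\<theta>. \<theta> \<notin> T \<Longrightarrow> (LINT x:X|\<nu>. p x \<theta>) < \<delta>"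
    using vanish[OF \<delta>(1) X(1)] by blast
  have "1 - \<epsilon> < measure (Fn n) T" for n
  proof -
    have "ennreal (1 - \<delta>) < ennreal (measure (Fn n) T + \<delta>)"
      using X(2)[of n] mixture_mass_le_mixing_mass[OF Fn X(1) T(1) _ T(2), of n] \<delta>(1)
      by (auto intro: less_le_trans)
    then have "1 - \<delta> < measure (Fn n) T + \<delta>"
      using \<delta> by (subst (asm) ennreal_less_iff) auto
    then show ?thesis using \<delta>(3) by linarith
  qed
  then show ?thesis using T(1) by blast
qed

lemma tendsto_weakly_imp_mixture_tendsto:
  assumes "tendsto_weakly Gs G"
  shows "(\<lambda>n. mixture p (Gs n) x) \<longlonglongrightarrow> mixture p G x"
  using assms bounded_p continuous_p unfolding tendsto_weakly_def mixture_def by blast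

lemma mixture_AE_convergent_subsequence:
  assumes F: "borel_prob F" and Fn: "\<And>n. borel_prob (Fn n)"
    and L1: "tendsto_L1 \<nu> (\<lambda>n. mixture p (Fn n)) (mixture p F)"
  shows "\<exists>r. strict_mono (r :: nat \<Rightarrow> nat) \<and>
    (AE x in \<nu>. (\<lambda>n. mixture p (Fn (r n)) x) \<longlonglongrightarrow> mixture p F x)"
proof -
  define u where "u n x = mixture p (Fn n) x - mixture p F x" for n x
  have u: "integrable \<nu> (u n)" for n
    unfolding u_def
    by (intro Bochner_Integration.integrable_diff integrable_mixture[OF Fn] integrable_mixture[OF F])
  have "(\<lambda>n. enn2real (\<integral>\<^sup>+x. ennreal (norm (u n x)) \<partial>\<nu>)) \<longlonglongrightarrow> 0"
    using L1 unfolding tendsto_L1_def u_def by (intro tendsto_enn2real) auto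
  moreover have "enn2real (\<integral>\<^sup>+x. ennreal (norm (u n x)) \<partial>\<nu>) = (\<integral>x. norm (u n x) \<partial>\<nu>)" for n
    using u[of n] by (intro integral_eq_nn_integral[symmetric]) auto
  ultimately obtain r where "strict_mono (r :: nat \<Rightarrow> nat)" "AE x in \<nu>. (\<lambda>n. u (r n) x) \<longlonglongrightarrow> 0"
    using tendsto_L1_AE_subseq[of \<nu> u] u by auto
  then show ?thesis unfolding u_def by (auto simp: LIM_zero_iff)
qed

end

section \<open>Weak convergence of the mixing measures\<close>

theorem theorem3:
  fixes \<nu> :: "'x::polish_space measure"
    and p :: "'x \<Rightarrow> 't::{metric_space, second_countable_topology} \<Rightarrow> real"
    and F :: "'t measure"
    and Fn :: "nat \<Rightarrow> 't measure"
  assumes "sigma_finite_measure \<nu>" and "sets \<nu> = sets borel"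
    and sampling_density: "\<And>\<theta>. density_wrt \<nu> (\<lambda>x. p x \<theta>)"
    and "borel_prob F" and "\<And>n. borel_prob (Fn n)"
    and L1: "tendsto_L1 \<nu> (\<lambda>n. mixture p (Fn n)) (mixture p F)"
    and A2: "identifiable \<nu> p"
    and A3: "\<And>x. bounded (range (\<lambda>\<theta>. p x \<theta>)) \<and> continuous_on UNIV (\<lambda>\<theta>. p x \<theta>)"
    and A4: "\<And>\<epsilon> X0. 0 < \<epsilon> \<Longrightarrow> compact X0 \<Longrightarrow>
               \<exists>T0. compact T0 \<and> (\<forall>\<theta>. \<theta> \<notin> T0 \<longrightarrow> (LINT x:X0|\<nu>. p x \<theta>) < \<epsilon>)"
  shows "tendsto_weakly Fn F"
proof -
  interpret sigma_finite_measure \<nu> by fact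
  interpret sampling_model \<nu> p
    by standard (use assms(2) sampling_density A3 in auto)
  note F = \<open>borel_prob F\<close> and Fn = \<open>\<And>n. borel_prob (Fn n)\<close>
  have tight: "\<exists>T. compact T \<and> (\<forall>n. 1 - \<epsilon> < measure (Fn n) T)" if "0 < \<epsilon>" for \<epsilon>
    by (rule mixing_measures_tight[OF F Fn L1 A4 that])
  show ?thesis
    unfolding tendsto_weakly_def
  proof (intro allI impI LIMSEQ_if_subseqs_have_convergent_subseq)
    fix f :: "'t \<Rightarrow> real" and r :: "nat \<Rightarrow> nat"
    assume f: "continuous_on UNIV f" "bounded (range f)" and r: "strict_mono r"
    have "tendsto_L1 \<nu> (\<lambda>n. mixture p (Fn (r n))) (mixture p F)"
      using LIMSEQ_subseq_LIMSEQ[OF L1[unfolded tendsto_L1_def] r]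
      unfolding tendsto_L1_def comp_def .
    from mixture_AE_convergent_subsequence[OF F Fn this]
    obtain r1 where r1: "strict_mono (r1 :: nat \<Rightarrow> nat)"
      and ae: "AE x in \<nu>. (\<lambda>n. mixture p (Fn (r (r1 n))) x) \<longlonglongrightarrow> mixture p F x"
      by blast
    have "\<exists>T. compact T \<and> (\<forall>n. 1 - \<epsilon> < measure (Fn (r (r1 n))) T)" if "0 < \<epsilon>" for \<epsilon>
      using tight[OF that] by blast
    from tight_imp_weakly_convergent_subsequence[OF Fn this]
    obtain r2 G where r2: "strict_mono (r2 :: nat \<Rightarrow> nat)" and G: "borel_prob G"
      and weak: "tendsto_weakly (\<lambda>n. Fn (r (r1 (r2 n)))) G"
      by blast
    from ae have "AE x in \<nu>. mixture p F x = mixture p G x"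
    proof eventually_elim
      case (elim x)
      then have "(\<lambda>n. mixture p (Fn (r (r1 (r2 n)))) x) \<longlonglongrightarrow> mixture p F x"
        using LIMSEQ_subseq_LIMSEQ[OF elim r2] by (simp add: comp_def)
      then show ?case
        using tendsto_weakly_imp_mixture_tendsto[OF weak] by (rule LIMSEQ_unique)
    qed
    then have "F = G"
      using A2 F G unfolding identifiable_def by blast
    then have "(\<lambda>n. \<integral>\<theta>. f \<theta> \<partial>Fn (r (r1 (r2 n)))) \<longlonglongrightarrow> (\<integral>\<theta>. f \<theta> \<partial>F)"
      using weak f unfolding tendsto_weakly_def by blast
    then show "\<exists>r'. strict_mono (r' :: nat \<Rightarrow> nat) \<and>
        (\<lambda>n. \<integral>\<theta>. f \<theta> \<partial>Fn (r (r' n))) \<longlonglongrightarrow> (\<integral>\<theta>. f \<theta> \<partial>F)"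
      using strict_mono_o[OF r1 r2] by (intro exI[of _ "r1 \<circ> r2"]) (simp add: comp_def)
  qed
qed

end
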